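(* Let $P\subset\mathbb{R}^n$ be a full-dimensional $0/1$-polytope. Then $P$ is indecomposable if one of the following conditions holds: (i) the $f$-polynomial $f_P(t)$ is irreducible (over $\mathbb{Q}$); (ii) the Ehrhart polynomial $\mathrm{Ehr}_P(m)$ is irreducible (over $\mathbb{Q}$); (iii) the graph $G_P=([n],E)$, which has an edge $ij$ for every pair of distinct coordinates $i,j$ for which there is a facet normal $a\in\mathbb{R}^n$ of $P$ with $a_ia_j\neq 0$, is connected.
   Context: $[n]=\{1,\dots,n\}$. Polytopes are nonempty convex polytopes. A polytope $P\subset\mathbb{R}^n$ is a $0/1$-polytope if all its vertices lie in $\{0,1\}^n$. The Minkowski sum is $Q+R=\{q+r: q\in Q, r\in R\}$. Two polytopes are homothetic if one is obtained from the other by a translation and a dilation with positive factor. A polytope $P$ is decomposable if there are polytopes $Q,R$ with $P=Q+R$ such that neither $Q$ nor $R$ is homothetic to $P$; otherwise $P$ is indecomposable. The $f$-polynomial is $f_P(t)=\sum_F t^{\dim F}$, the sum over all nonempty faces $F$ of $P$ (including $P$ itself). The Ehrhart polynomial $\mathrm{Ehr}_P$ is the polynomial with $\mathrm{Ehr}_P(m)=|mP\cap\mathbb{Z}^n|$ for all integers $m\ge 1$. A facet normal is a normal vector of a facet-defining hyperplane of $P$. *)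

theory Defs
  imports "HOL-Analysis.Analysis" "HOL-Computational_Algebra.Computational_Algebra"
begin

definition zero_one_polytope :: "(real ^ 'n::finite) set \<Rightarrow> bool" where
  "zero_one_polytope P \<longleftrightarrow>
     polytope P \<and> P \<noteq> {} \<and> (\<forall>v. v extreme_point_of P \<longrightarrow> (\<forall>i. v $ i \<in> {0, 1}))"

definition full_dimensional :: "'a::euclidean_space set \<Rightarrow> bool" where
  "full_dimensional P \<longleftrightarrow> aff_dim P = int DIM('a)"

definition homothetic :: "'a::real_vector set \<Rightarrow> 'a set \<Rightarrow> bool" where
  "homothetic P Q \<longleftrightarrow> (\<exists>c t. c > 0 \<and> Q = (\<lambda>x. t + c *\<^sub>R x) ` P)"

text \<open>The library predicate \<^const>\<open>polytope\<close> admits the empty set, which is excluded here;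
  \<open>Q + R\<close> is the elementwise (Minkowski) sum of sets.\<close>

definition decomposable :: "'a::euclidean_space set \<Rightarrow> bool" where
  "decomposable P \<longleftrightarrow>
     (\<exists>Q R. polytope Q \<and> Q \<noteq> {} \<and> polytope R \<and> R \<noteq> {} \<and> P = Q + R \<and>
            \<not> homothetic Q P \<and> \<not> homothetic R P)"

abbreviation indecomposable :: "'a::euclidean_space set \<Rightarrow> bool" where
  "indecomposable P \<equiv> \<not> decomposable P"

text \<open>Both polynomials below have type \<^typ>\<open>rat poly\<close>, so that \<^const>\<open>irreducible\<close> means
  irreducibility over the rationals. The faces \<open>F\<close> include \<open>P\<close> itself; the library relation
  \<open>F face_of P\<close> also admits \<open>F = {}\<close>, which is left out of the sum.\<close>

definition f_polynomial :: "'a::euclidean_space set \<Rightarrow> rat poly" where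
  "f_polynomial P = (\<Sum>F | F face_of P \<and> F \<noteq> {}. monom 1 (nat (aff_dim F)))"

definition integer_points :: "(real ^ 'n::finite) set" where
  "integer_points = {x. \<forall>i. x $ i \<in> \<int>}"

text \<open>There is at most one polynomial as described, as two polynomials that agree at all positive
  integers are equal. For polytopes with integral vertices it exists by Ehrhart's theorem.\<close>

definition ehrhart_polynomial :: "(real ^ 'n::finite) set \<Rightarrow> rat poly" where
  "ehrhart_polynomial P =
     (THE p. \<forall>m::nat. m \<ge> 1 \<longrightarrow>
        poly p (of_nat m) = of_nat (card ((\<lambda>x. real m *\<^sub>R x) ` P \<inter> integer_points)))"

text \<open>Normals of either sign are allowed. A hyperplane that meets \<open>P\<close> exactly in a facet
  is automatically a supporting hyperplane of \<open>P\<close>.\<close>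

definition facet_normal :: "'a::euclidean_space set \<Rightarrow> 'a \<Rightarrow> bool" where
  "facet_normal P a \<longleftrightarrow> a \<noteq> 0 \<and> (\<exists>b. (P \<inter> {x. a \<bullet> x = b}) facet_of P)"

text \<open>The graph \<open>G_P\<close> has the coordinates, i.e. all elements of the index type, as vertices and is
  given by its symmetric, irreflexive set of edges.\<close>

definition coordinate_edges :: "(real ^ 'n::finite) set \<Rightarrow> ('n \<times> 'n) set" where
  "coordinate_edges P = {(i, j). i \<noteq> j \<and> (\<exists>a. facet_normal P a \<and> a $ i * a $ j \<noteq> 0)}"

definition coordinate_graph_connected :: "(real ^ 'n::finite) set \<Rightarrow> bool" where
  "coordinate_graph_connected P \<longleftrightarrow> (\<forall>i j. (i, j) \<in> (coordinate_edges P)\<^sup>*)"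

end

theory Submission
  imports Defs
begin

text \<open>A decomposable full-dimensional \<open>0/1\<close>-polytope is, up to the order of the coordinates, a product of two
  \<open>0/1\<close>-polytopes of positive dimension, and each of the three conditions forbids such a product.

  Let \<open>P = Q + R\<close>. In every coordinate \<open>P\<close> ranges exactly over \<open>[0, 1]\<close>, and the widths \<open>l i\<close> of \<open>Q\<close> and
  \<open>1 - l i\<close> of \<open>R\<close> add up to 1. A vertex of \<open>P\<close> is extreme in every single coordinate, so its parts in
  \<open>Q\<close> and \<open>R\<close> are extreme in every single coordinate as well; hence \<open>Q\<close> is a translate of the image of
  \<open>P\<close> under the diagonal matrix \<open>l\<close>, and \<open>R\<close> one of the image under \<open>1 - l\<close>
  (\<open>summands_are_coordinate_scalings\<close>). If \<open>l\<close> were constant, one summand would be homothetic to \<open>P\<close>.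
  On a facet of \<open>P\<close> with normal \<open>a\<close> the functional \<open>l * a\<close> is constant too, so it is a multiple of \<open>a\<close>,
  and \<open>l\<close> is constant on the support of \<open>a\<close> (\<open>mixing_constant_on_facet_normal\<close>). A level set \<open>I\<close> of
  \<open>l\<close> therefore contains or avoids the support of each facet normal. So no edge of the
  coordinate graph leaves \<open>I\<close>, which settles (iii); and every facet inequality involves only coordinates
  in \<open>I\<close> or only coordinates outside \<open>I\<close>, so \<open>P\<close> is the product of its projections to these two sets
  of coordinates (\<open>mixed_point_mem\<close>).

  For a product, both polynomials are products. For the \<open>f\<close>-polynomial this holds because the nonempty
  faces of a product are the products of nonempty faces (\<open>f_polynomial_Times\<close>). For the Ehrhart
  polynomial it holds because lattice points of the dilates are counted coordinatewise. Both factors have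
  positive degree, so the product is reducible.

  The Ehrhart polynomial is a definite description, so the argument depends on Ehrhart's
  theorem that it exists (\<open>ehrhart_polynomial_exists\<close>). It is proved for lattice polytopes
  by writing each point of the dilate \<open>m P\<close> as the lexicographically smallest nonnegative combination of the
  vertices of total weight \<open>m\<close>. Whether a combination is smallest depends only on its support
  (\<open>lex_cell\<close>), so the lattice points of \<open>m P\<close> fall into \<open>m\<close>-fold dilates of open simplices that do not
  depend on \<open>m\<close>. In each of them the weights are split into a positive part bounded by 1 and natural numbers, and the latter are
  counted by a binomial coefficient that is polynomial in \<open>m\<close>.\<close>

(* The dollar sign denotes vector components throughout. *)
no_notation fps_nth (infixl \<open>$\<close> 75)

section \<open>Minkowski summands of 0/1-polytopes\<close>

text \<open>If a hyperplane separated a point \<open>q\<close> of \<open>Q\<close> strictly from \<open>K\<close>, then \<open>q\<close> plus a point of \<open>R\<close> that is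
  extreme in the normal direction would be separated from \<open>K + R\<close>.\<close>

lemma minkowski_cancel_subset:
  fixes K Q R :: "'a::euclidean_space set"
  assumes "closed K" "convex K" "compact R" "R \<noteq> {}" "Q + R \<subseteq> K + R"
  shows "Q \<subseteq> K"
proof (rule subsetI, rule ccontr)
  fix q assume q: "q \<in> Q" "q \<notin> K"
  obtain a b where a: "a \<bullet> q < b" "\<And>k. k \<in> K \<Longrightarrow> b < a \<bullet> k"
    using separating_hyperplane_closed_point[OF \<open>convex K\<close> \<open>closed K\<close> \<open>q \<notin> K\<close>] by blast
  have "continuous_on R ((\<bullet>) a)" by (intro continuous_intros)
  then obtain r where r: "r \<in> R" "\<And>s. s \<in> R \<Longrightarrow> a \<bullet> r \<le> a \<bullet> s"
    using continuous_attains_inf[OF \<open>compact R\<close> \<open>R \<noteq> {}\<close>] by blast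
  have "q + r \<in> K + R" using assms q r by (meson set_plus_intro subsetD)
  then obtain k s where ks: "k \<in> K" "s \<in> R" "q + r = k + s" by (auto elim: set_plus_elim)
  have "a \<bullet> q + a \<bullet> r = a \<bullet> k + a \<bullet> s"
    using ks(3) by (metis inner_add_right)
  then show False using a(1) a(2)[OF ks(1)] r(2)[OF ks(2)] by linarith
qed

lemma zero_one_polytope_convex_hull:
  assumes "zero_one_polytope P"
  shows "P = convex hull {v. v extreme_point_of P}"
  using assms unfolding zero_one_polytope_def
  by (simp add: Krein_Milman_Minkowski polytope_imp_compact polytope_imp_convex)

lemma zero_one_polytope_bounds:
  assumes "zero_one_polytope P" "x \<in> P"
  shows "0 \<le> x $ i" "x $ i \<le> 1"
proof -
  have "convex hull {v. v extreme_point_of P} \<subseteq> {x. 0 \<le> x $ i} \<inter> {x. x $ i \<le> 1}"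
  proof (rule hull_minimal)
    show "{v. v extreme_point_of P} \<subseteq> {x. 0 \<le> x $ i} \<inter> {x. x $ i \<le> 1}"
      using assms(1) by (auto simp: zero_one_polytope_def) (metis zero_le_one order_refl)+
    have "convex {x::real^'a. 0 \<le> x $ i}" "convex {x::real^'a. x $ i \<le> 1}"
      by (auto simp: convex_def intro!: convex_bound_le)
    then show "convex ({x. 0 \<le> x $ i} \<inter> {x::real^'a. x $ i \<le> 1})" by (rule convex_Int)
  qed
  with assms zero_one_polytope_convex_hull show "0 \<le> x $ i" "x $ i \<le> 1" by blast+
qed

lemma full_dimensional_iff: "full_dimensional P \<longleftrightarrow> affine hull P = (UNIV :: 'a::euclidean_space set)"
  unfolding full_dimensional_def using aff_dim_eq_full by blast

lemma full_dimensional_not_in_hyperplane: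
  assumes "full_dimensional P" "a \<noteq> 0"
  obtains x where "x \<in> P" "a \<bullet> x \<noteq> b"
proof (rule ccontr)
  assume "\<not> thesis"
  then have "P \<subseteq> {x. a \<bullet> x = b}" using that by auto
  then have "affine hull P \<subseteq> {x. a \<bullet> x = b}" by (simp add: affine_hyperplane hull_minimal)
  then have *: "a \<bullet> x = b" for x using assms(1) full_dimensional_iff by auto
  from *[of 0] *[of a] assms(2) show False by simp
qed

text \<open>If all vertices agreed in a coordinate, then \<open>P\<close> would lie in a hyperplane.\<close>

lemma coordinate_values:
  fixes P :: "(real ^ 'n::finite) set"
  assumes "zero_one_polytope P" "full_dimensional P"
  obtains u w where "u \<in> P" "u $ i = 0" "w \<in> P" "w $ i = 1"
proof -
  let ?E = "{v. v extreme_point_of P}"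
  have hull: "P = convex hull ?E" using zero_one_polytope_convex_hull assms by blast
  have "\<exists>v\<in>?E. v $ i \<noteq> c" for c
  proof (rule ccontr)
    assume "\<not> ?thesis"
    then have "?E \<subseteq> {x. axis i 1 \<bullet> x = c}" by (auto simp: inner_axis')
    then have "P \<subseteq> {x. axis i 1 \<bullet> x = c}"
      using hull by (metis convex_hyperplane hull_minimal)
    moreover have "axis i (1::real) \<noteq> 0" by (simp add: axis_eq_0_iff)
    ultimately show False
      using full_dimensional_not_in_hyperplane[OF assms(2), of "axis i 1" c] by blast
  qed
  then obtain u w where "u extreme_point_of P" "u $ i \<noteq> 1" "w extreme_point_of P" "w $ i \<noteq> 0"
    by blast
  moreover from this have "u $ i = 0" "w $ i = 1" "u \<in> P" "w \<in> P"
    using assms(1) by (auto simp: zero_one_polytope_def extreme_point_of_def)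
  ultimately show ?thesis using that by blast
qed

text \<open>Products of vectors are coordinatewise, so \<open>l\<close> acts as a diagonal matrix. Its entries are the widths of \<open>Q\<close> in
  the coordinate directions, and \<open>t\<close> is the vector of the coordinatewise minima of \<open>Q\<close>. For a vertex
  \<open>v = q + r\<close> of \<open>P\<close>, each \<open>v $ i\<close> is the minimum 0 or the maximum 1 of that coordinate on \<open>P\<close>, so \<open>q $ i\<close>
  must be the minimum or the maximum on \<open>Q\<close>; this says \<open>q = t + l * v\<close>. Convexity extends the
  inclusion from vertices to \<open>P\<close>, and Minkowski cancellation turns the two inclusions into equalities.\<close>

lemma summands_are_coordinate_scalings:
  fixes P :: "(real ^ 'n::finite) set"
  assumes P: "zero_one_polytope P" "full_dimensional P"
    and QR: "polytope Q" "polytope R" "P = Q + R"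
  obtains t l where "Q = (\<lambda>x. t + l * x) ` P" "R = (\<lambda>x. (1 - l) * x - t) ` P"
    "\<And>i. 0 \<le> l $ i" "\<And>i. l $ i \<le> 1"
proof -
  have sum: "q + r \<in> P" if "q \<in> Q" "r \<in> R" for q r using that QR by auto
  (* m and n are the minimum and the maximum of the i-th coordinate on Q. *)
  have "\<exists>m n. (\<forall>q\<in>Q. \<forall>r\<in>R. (q + r) $ i = 0 \<longrightarrow> q $ i = m) \<and>
      (\<forall>q\<in>Q. \<forall>r\<in>R. (q + r) $ i = 1 \<longrightarrow> q $ i = n) \<and> m \<le> n \<and> n \<le> m + 1" for i
  proof -
    obtain u w where uw: "u \<in> P" "u $ i = 0" "w \<in> P" "w $ i = 1" using coordinate_values P by metis
    then obtain q r q' r' where "u = q + r" "w = q' + r'"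
      and mem: "q \<in> Q" "r \<in> R" "q' \<in> Q" "r' \<in> R"
      using QR by (metis set_plus_elim)
    with uw have eq: "q $ i + r $ i = 0" "q' $ i + r' $ i = 1" by auto
    have lo: "0 \<le> x $ i + y $ i" and hi: "x $ i + y $ i \<le> 1" if "x \<in> Q" "y \<in> R" for x y
      using zero_one_polytope_bounds[OF P(1) sum[OF that], of i] by auto
    have "x $ i = q $ i" if "x \<in> Q" "y \<in> R" "(x + y) $ i = 0" for x y
      using that lo[OF \<open>x \<in> Q\<close> mem(2)] lo[OF mem(1) \<open>y \<in> R\<close>] eq by auto
    moreover have "x $ i = q' $ i" if "x \<in> Q" "y \<in> R" "(x + y) $ i = 1" for x y
      using that hi[OF \<open>x \<in> Q\<close> mem(4)] hi[OF mem(3) \<open>y \<in> R\<close>] eq by auto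
    moreover have "q $ i \<le> q' $ i" "q' $ i \<le> q $ i + 1"
      using lo[OF mem(3,2)] lo[OF mem(1,4)] hi[OF mem(3,2)] hi[OF mem(1,4)] eq by linarith+
    ultimately show ?thesis by blast
  qed
  then obtain m n where
    m: "\<And>i q r. q \<in> Q \<Longrightarrow> r \<in> R \<Longrightarrow> (q + r) $ i = 0 \<Longrightarrow> q $ i = m i" and
    n: "\<And>i q r. q \<in> Q \<Longrightarrow> r \<in> R \<Longrightarrow> (q + r) $ i = 1 \<Longrightarrow> q $ i = n i" and
    mn: "\<And>i. m i \<le> n i" "\<And>i. n i \<le> m i + 1" by metis
  define t l where "t = (\<chi> i. m i)" and "l = (\<chi> i. n i - m i)"
  (* f x and g x are the parts of x in Q and in R. *)
  define f g where "f x = t + l * x" and "g x = (1 - l) * x - t" for x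
  have fg: "f x + g x = x" for x by (simp add: f_def g_def vec_eq_iff algebra_simps)
  have vert: "f v \<in> Q \<and> g v \<in> R" if v: "v extreme_point_of P" for v
  proof -
    have "v \<in> P" using v by (simp add: extreme_point_of_def)
    then obtain q r where qr: "q \<in> Q" "r \<in> R" "v = q + r" using QR by (metis set_plus_elim)
    have "q $ i = f v $ i" for i
    proof -
      have "v $ i = 0 \<or> v $ i = 1" using P(1) v by (auto simp: zero_one_polytope_def)
      then show ?thesis
        using m[OF qr(1,2), of i] n[OF qr(1,2), of i]
        unfolding qr(3)[symmetric] by (auto simp: f_def t_def l_def)
    qed
    then have "q = f v" by (simp add: vec_eq_iff)
    moreover from this have "r = g v" using fg[of v] qr(3) by (metis add_left_cancel)
    ultimately show ?thesis using qr by blast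
  qed
  have lin: "linear ((*) l)" "linear ((*) (1 - l))"
    by (auto intro!: linearI simp: vec_eq_iff algebra_simps)
  have cf: "compact (f ` P)" "convex (f ` P)" and cg: "compact (g ` P)" "convex (g ` P)"
  proof -
    have "f ` P = (+) t ` ((*) l ` P)" "g ` P = (+) (-t) ` ((*) (1 - l) ` P)"
      by (simp_all add: f_def g_def image_image)
    moreover have "polytope P" using P(1) by (simp add: zero_one_polytope_def)
    ultimately have "polytope (f ` P)" "polytope (g ` P)"
      using lin by (simp_all only: polytope_linear_image polytope_translation_eq)
    then show "compact (f ` P)" "convex (f ` P)" "compact (g ` P)" "convex (g ` P)"
      by (auto simp: polytope_imp_compact polytope_imp_convex)
  qed
  have hull: "P = convex hull {v. v extreme_point_of P}"
    using zero_one_polytope_convex_hull P by blast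
  have into: "f ` P \<subseteq> Q \<and> g ` P \<subseteq> R"
  proof -
    have "convex {x. f x \<in> Q}" "convex {x. g x \<in> R}"
    proof -
      have "y \<in> (+) (-s) ` A \<longleftrightarrow> s + y \<in> A" for s y and A :: "(real ^ 'n) set"
        by (auto intro: image_eqI[where x = "s + y"])
      from this[of _ t] this[of _ "-t"]
      have "{x. f x \<in> Q} = (*) l -` ((+) (-t) ` Q)" "{x. g x \<in> R} = (*) (1 - l) -` ((+) t ` R)"
        by (auto simp: f_def g_def)
      then show "convex {x. f x \<in> Q}" "convex {x. g x \<in> R}"
        using lin QR(1,2) by (auto intro!: convex_linear_vimage simp: polytope_imp_convex)
    qed
    then have "P \<subseteq> {x. f x \<in> Q}" "P \<subseteq> {x. g x \<in> R}"
      using vert by (subst hull; intro hull_minimal; auto)+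
    then show ?thesis by auto
  qed
  have ne: "Q \<noteq> {}" "R \<noteq> {}" using P(1) QR(3) by (auto simp: zero_one_polytope_def set_plus_def)
  have sub: "Q + R \<subseteq> f ` P + g ` P"
    unfolding QR(3)[symmetric] by (rule subsetI) (metis fg imageI set_plus_intro)
  have "Q \<subseteq> f ` P"
  proof (rule minkowski_cancel_subset)
    show "Q + R \<subseteq> f ` P + R"
      by (rule order_trans[OF sub set_plus_mono2]) (use into in blast)+
  qed (use cf ne QR(1,2) in \<open>auto simp: compact_imp_closed polytope_imp_compact\<close>)
  moreover have "R \<subseteq> g ` P"
  proof (rule minkowski_cancel_subset)
    show "R + Q \<subseteq> g ` P + Q"
      unfolding add.commute[of R Q] add.commute[of "g ` P" Q]
      by (rule order_trans[OF sub set_plus_mono2]) (use into in blast)+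
  qed (use cg ne QR(1,2) in \<open>auto simp: compact_imp_closed polytope_imp_compact\<close>)
  ultimately have "Q = f ` P" "R = g ` P" using into by auto
  moreover have "f = (\<lambda>x. t + l * x)" "g = (\<lambda>x. (1 - l) * x - t)"
    by (simp_all add: fun_eq_iff f_def g_def)
  moreover have "0 \<le> l $ i" "l $ i \<le> 1" for i
    using mn[of i] by (simp_all add: l_def)
  ultimately show thesis using that[of t l] by simp
qed

text \<open>A point of \<open>Q = t + l * P\<close> plus a point of \<open>R = (1 - l) * P - t\<close> lies in \<open>P\<close>. For a constant \<open>l = c\<close> the summand
  \<open>Q\<close> would be homothetic to \<open>P\<close> if \<open>c > 0\<close>, and \<open>R\<close> would be a translate of \<open>P\<close> if \<open>c = 0\<close>.\<close>

lemma decomposable_nonuniform_mixing: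
  fixes P :: "(real ^ 'n::finite) set"
  assumes P: "zero_one_polytope P" "full_dimensional P" and "decomposable P"
  obtains l i j where "\<And>x y. x \<in> P \<Longrightarrow> y \<in> P \<Longrightarrow> l * x + (1 - l) * y \<in> P" "l $ i \<noteq> l $ j"
proof -
  obtain Q R where QR: "polytope Q" "polytope R" "P = Q + R"
    and nh: "\<not> homothetic Q P" "\<not> homothetic R P"
    using \<open>decomposable P\<close> unfolding decomposable_def by blast
  obtain t l where Q: "Q = (\<lambda>x. t + l * x) ` P" and R: "R = (\<lambda>x. (1 - l) * x - t) ` P"
    and l: "\<And>i. 0 \<le> l $ i" "\<And>i. l $ i \<le> 1"
    by (rule summands_are_coordinate_scalings[OF P QR]) (rule that)
  have "l * x + (1 - l) * y \<in> P" if "x \<in> P" "y \<in> P" for x y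
  proof -
    have "(t + l * x) + ((1 - l) * y - t) \<in> Q + R"
      using that unfolding Q R by (intro set_plus_intro imageI)
    then show ?thesis using QR(3) by (simp add: algebra_simps)
  qed
  moreover have "\<exists>i j. l $ i \<noteq> l $ j"
  proof (rule ccontr)
    assume "\<not> ?thesis"
    then obtain c where c: "\<And>i. l $ i = c" by metis
    have lx: "l * x = c *\<^sub>R x" "(1 - l) * x = (1 - c) *\<^sub>R x" for x
      by (simp_all add: vec_eq_iff c)
    consider "c > 0" | "c = 0" using c l(1) by (metis less_eq_real_def)
    then show False
    proof cases
      case 1
      have "P = (\<lambda>x. - (t /\<^sub>R c) + (1 / c) *\<^sub>R x) ` Q"
        using 1 unfolding Q lx by (simp add: image_image scaleR_add_right divide_inverse)
      with 1 nh(1) show False unfolding homothetic_def by (metis zero_less_divide_1_iff)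
    next
      case 2
      have "P = (\<lambda>x. t + 1 *\<^sub>R x) ` R" unfolding R lx 2 by (simp add: image_image)
      with nh(2) show False unfolding homothetic_def by (metis zero_less_one)
    qed
  qed
  ultimately show thesis using that by blast
qed

text \<open>For \<open>x\<close> and \<open>p\<close> in the facet, \<open>l * x + (1 - l) * p\<close> and \<open>l * p + (1 - l) * x\<close> are points of \<open>P\<close> with the same midpoint
  as \<open>x\<close> and \<open>p\<close>, so both lie in the facet. Hence \<open>l * a\<close> is constant on the facet, as \<open>a\<close> is. The facet
  spans a hyperplane, so \<open>l * a\<close> is a multiple \<open>c\<close> of \<open>a\<close>.\<close>

lemma mixing_constant_on_facet_normal:
  fixes P :: "(real ^ 'n::finite) set"
  assumes full: "full_dimensional P"
    and mix: "\<And>x y. x \<in> P \<Longrightarrow> y \<in> P \<Longrightarrow> l * x + (1 - l) * y \<in> P"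
    and "facet_normal P a"
  obtains c where "\<And>i. a $ i \<noteq> 0 \<Longrightarrow> l $ i = c"
proof -
  obtain b where a: "a \<noteq> 0" and facet: "(P \<inter> {x. a \<bullet> x = b}) facet_of P"
    using \<open>facet_normal P a\<close> unfolding facet_normal_def by blast
  define F where "F = P \<inter> {x. a \<bullet> x = b}"
  have F: "F face_of P" "F \<noteq> {}" "aff_dim F = int DIM(real ^ 'n) - 1"
    using facet full unfolding facet_of_def F_def full_dimensional_def by auto
  have shift: "(l * a) \<bullet> x = a \<bullet> (l * x)" for x
    by (simp add: inner_vec_def algebra_simps)
  have const: "(l * a) \<bullet> x = (l * a) \<bullet> p" if "x \<in> F" "p \<in> F" for x p
  proof -
    let ?y = "l * x + (1 - l) * p" and ?z = "l * p + (1 - l) * x"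
    have "midpoint ?y ?z = midpoint x p"
      by (simp add: midpoint_def algebra_simps)
    also have "\<dots> \<in> F"
      using face_of_imp_convex[OF F(1)] that by (metis convex_contains_segment midpoint_in_closed_segment subsetD)
    finally have "midpoint ?y ?z \<in> F" .
    moreover have "?y \<in> P" "?z \<in> P" using mix that by (auto simp: F_def)
    ultimately have "?y \<in> F"
    proof (cases "?y = ?z")
      case False
      then have "midpoint ?y ?z \<in> open_segment ?y ?z" by (rule midpoint_in_open_segment[THEN iffD2])
      then show ?thesis using F(1) \<open>midpoint ?y ?z \<in> F\<close> \<open>?y \<in> P\<close> \<open>?z \<in> P\<close> by (blast dest: face_ofD)
    qed simp
    then have "a \<bullet> ?y = a \<bullet> p" using that by (simp add: F_def)
    then show ?thesis unfolding shift by (simp add: algebra_simps inner_add_right inner_diff_right)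
  qed
  obtain p where p: "p \<in> F" using F(2) by blast
  have hyp: "affine hull F = {x. a \<bullet> x = b}"
  proof (rule affine_dim_equal)
    show "affine hull F \<subseteq> {x. a \<bullet> x = b}"
      by (intro hull_minimal affine_hyperplane) (auto simp: F_def)
  qed (use F a in \<open>auto simp: affine_hyperplane aff_dim_hyperplane\<close>)
  have "affine hull F \<subseteq> {x. (l * a) \<bullet> x = (l * a) \<bullet> p}"
    by (intro hull_minimal affine_hyperplane) (use const p in blast)
  then have perp: "(l * a) \<bullet> y = 0" if "a \<bullet> y = 0" for y
  proof -
    have "p + y \<in> affine hull F" using hyp p that by (simp add: F_def inner_add_right)
    then have "(l * a) \<bullet> (p + y) = (l * a) \<bullet> p"
      using \<open>affine hull F \<subseteq> _\<close> by blast
    then show ?thesis by (simp add: inner_add_right)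
  qed
  (* Projecting l * a to the line of a leaves a vector orthogonal to a, hence to itself. *)
  define c where "c = (l * a) \<bullet> a / (a \<bullet> a)"
  have "a \<bullet> (l * a - c *\<^sub>R a) = 0" using a by (simp add: c_def inner_diff_right inner_commute)
  then have "(l * a - c *\<^sub>R a) \<bullet> (l * a - c *\<^sub>R a) = 0"
    using perp by (simp add: inner_diff_left)
  then have "l * a = c *\<^sub>R a" by simp
  then have "l $ i * a $ i = c * a $ i" for i by (metis vector_mult_component vector_scaleR_component real_scaleR_def)
  then show thesis using that by (metis mult_right_cancel)
qed

text \<open>The set \<open>I\<close> is a level set of the nonconstant vector \<open>l\<close> of \<open>decomposable_nonuniform_mixing\<close>.\<close>

lemma decomposable_facet_normals_split:
  fixes P :: "(real ^ 'n::finite) set"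
  assumes P: "zero_one_polytope P" "full_dimensional P" and "decomposable P"
  obtains I i j where "i \<in> I" "j \<notin> I"
    "\<And>a. facet_normal P a \<Longrightarrow> (\<forall>k. k \<notin> I \<longrightarrow> a $ k = 0) \<or> (\<forall>k\<in>I. a $ k = 0)"
proof -
  obtain l i j where mix: "\<And>x y. x \<in> P \<Longrightarrow> y \<in> P \<Longrightarrow> l * x + (1 - l) * y \<in> P"
    and ij: "l $ i \<noteq> l $ j"
    by (rule decomposable_nonuniform_mixing[OF assms]) (rule that)
  show thesis
  proof
    show "i \<in> {k. l $ k = l $ i}" "j \<notin> {k. l $ k = l $ i}" using ij by auto
    fix a assume a: "facet_normal P a"
    obtain c where "\<And>k. a $ k \<noteq> 0 \<Longrightarrow> l $ k = c"
      by (rule mixing_constant_on_facet_normal[OF P(2) _ a, of l]) (rule mix, assumption+, rule that)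
    then show "(\<forall>k. k \<notin> {k. l $ k = l $ i} \<longrightarrow> a $ k = 0) \<or> (\<forall>k\<in>{k. l $ k = l $ i}. a $ k = 0)"
      by force
  qed
qed

section \<open>Splitting a polytope along a set of coordinates\<close>

text \<open>The image stays in the ambient space, as the coordinates of a vector type cannot be restricted to the
  set \<open>I\<close>.\<close>

definition coord_proj :: "'n set \<Rightarrow> real ^ 'n \<Rightarrow> real ^ 'n::finite" where
  "coord_proj I x = (\<chi> i. if i \<in> I then x $ i else 0)"

lemma coord_proj_nth [simp]: "coord_proj I x $ i = (if i \<in> I then x $ i else 0)"
  by (simp add: coord_proj_def)

lemma linear_coord_proj: "linear (coord_proj I)"
  by (auto intro!: linearI simp: vec_eq_iff)

text \<open>A full-dimensional polytope is cut out by its facet inequalities. Each of them takes at the mixed point the same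
  value as at \<open>x\<close> or as at \<open>y\<close>.\<close>

lemma mixed_point_mem:
  fixes P :: "(real ^ 'n::finite) set"
  assumes "polytope P" "full_dimensional P"
    and split: "\<And>a. facet_normal P a \<Longrightarrow> (\<forall>k. k \<notin> I \<longrightarrow> a $ k = 0) \<or> (\<forall>k\<in>I. a $ k = 0)"
    and "x \<in> P" "y \<in> P"
  shows "coord_proj I x + coord_proj (- I) y \<in> P"
proof -
  have "polyhedron P" using assms(1) by (rule polytope_imp_polyhedron)
  then obtain \<F> where fin: "finite \<F>" and P: "P = affine hull P \<inter> \<Inter>\<F>"
    and ex: "\<forall>h\<in>\<F>. \<exists>a b. a \<noteq> 0 \<and> h = {x. a \<bullet> x \<le> b}"
    and min: "\<And>\<F>'. \<F>' \<subset> \<F> \<Longrightarrow> P \<subset> affine hull P \<inter> \<Inter>\<F>'"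
    unfolding polyhedron_Int_affine_minimal by meson
  obtain a b where ab: "\<And>h. h \<in> \<F> \<Longrightarrow> a h \<noteq> 0 \<and> h = {x. a h \<bullet> x \<le> b h}"
    using bchoice[OF ex] by (metis (no_types))
  have UN: "affine hull P = UNIV" using assms(2) full_dimensional_iff by blast
  have "coord_proj I x + coord_proj (- I) y \<in> h" if h: "h \<in> \<F>" for h
  proof -
    have "facet_normal P (a h)"
      unfolding facet_normal_def using ab[OF h] facet_of_polyhedron_explicit[OF fin P ab min] h by blast
    then have "a h \<bullet> (coord_proj I x + coord_proj (- I) y) = a h \<bullet> x \<or>
        a h \<bullet> (coord_proj I x + coord_proj (- I) y) = a h \<bullet> y"
      using split[of "a h"] by (auto simp: inner_vec_def intro!: sum.cong)
    moreover have "x \<in> h" "y \<in> h" using equalityD1[OF P] assms(4,5) h by blast+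
    moreover have "z \<in> h \<longleftrightarrow> a h \<bullet> z \<le> b h" for z using ab[OF h] by blast
    ultimately show ?thesis by fastforce
  qed
  then have "coord_proj I x + coord_proj (- I) y \<in> affine hull P \<inter> \<Inter>\<F>" using UN by blast
  then show ?thesis using equalityD2[OF P] by blast
qed

lemma zero_one_polytope_vertices:
  fixes P :: "(real ^ 'n::finite) set"
  assumes "zero_one_polytope P"
  shows "finite {v. v extreme_point_of P}" "{v. v extreme_point_of P} \<subseteq> integer_points"
proof -
  have "polytope P" using assms by (simp add: zero_one_polytope_def)
  then show "finite {v. v extreme_point_of P}"
    by (simp add: finite_polyhedron_extreme_points polytope_imp_polyhedron)
  show "{v. v extreme_point_of P} \<subseteq> integer_points"
  proof
    fix v assume "v \<in> {v. v extreme_point_of P}"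
    then have "v $ i \<in> {0, 1}" for i using assms by (simp add: zero_one_polytope_def)
    then have "v $ i \<in> \<int>" for i by (metis Ints_0 Ints_1 insertE singletonD)
    then show "v \<in> integer_points" by (simp add: integer_points_def)
  qed
qed

text \<open>The two distinct points \<open>u\<close> and \<open>v\<close> witness that the projection has positive dimension: it is not
  constant in the coordinate \<open>i\<close>.\<close>

lemma zero_one_polytope_coord_proj:
  fixes P :: "(real ^ 'n::finite) set"
  assumes P: "zero_one_polytope P" "full_dimensional P" and "i \<in> I"
  obtains V u v where "finite V" "V \<subseteq> integer_points" "coord_proj I ` P = convex hull V"
    "u \<in> V" "v \<in> V" "u \<noteq> v"
proof -
  let ?E = "{v. v extreme_point_of P}"
  let ?V = "coord_proj I ` ?E"
  have hull: "coord_proj I ` P = convex hull ?V"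
    using zero_one_polytope_convex_hull[OF P(1)] convex_hull_linear_image[OF linear_coord_proj] by metis
  have "finite ?V"
    using zero_one_polytope_vertices(1)[OF P(1)] by simp
  moreover have "?V \<subseteq> integer_points"
    using zero_one_polytope_vertices(2)[OF P(1)] by (force simp: integer_points_def)
  moreover have "\<exists>u\<in>?V. \<exists>v\<in>?V. u \<noteq> v"
  proof (rule ccontr)
    assume "\<not> ?thesis"
    then obtain z where "?V \<subseteq> {z}" by blast
    then have "convex hull ?V \<subseteq> {z}" by (simp add: hull_minimal)
    then have "x $ i = z $ i" if "x \<in> P" for x
      using that \<open>i \<in> I\<close> hull by (metis (no_types, lifting) coord_proj_nth image_eqI singletonD subsetD)
    then show False using coordinate_values[OF P, of i] by (metis zero_neq_one)
  qed
  ultimately show thesis using that hull by blast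
qed

section \<open>The f-polynomial of a product\<close>

lemma span_Times:
  assumes "0 \<in> A" "0 \<in> B"
  shows "span (A \<times> B) = span A \<times> span B"
proof
  show "span (A \<times> B) \<subseteq> span A \<times> span B"
    by (intro span_minimal real_vector.subspace_Times subspace_span) (auto intro: span_base)
  show "span A \<times> span B \<subseteq> span (A \<times> B)"
  proof
    fix z assume "z \<in> span A \<times> span B"
    then have "(fst z, 0) \<in> span (A \<times> {0})" "(0, snd z) \<in> span ({0} \<times> B)"
      by (auto simp: real_vector.span_Times_sing1 real_vector.span_Times_sing2)
    then have "(fst z, 0) \<in> span (A \<times> B)" "(0, snd z) \<in> span (A \<times> B)"
      using assms span_mono[of "A \<times> {0}" "A \<times> B"] span_mono[of "{0} \<times> B" "A \<times> B"] by auto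
    then have "(fst z, 0) + (0, snd z) \<in> span (A \<times> B)" by (rule span_add)
    then show "z \<in> span (A \<times> B)" by simp
  qed
qed

lemma aff_dim_Times:
  fixes A :: "'a::euclidean_space set" and B :: "'b::euclidean_space set"
  assumes "A \<noteq> {}" "B \<noteq> {}"
  shows "aff_dim (A \<times> B) = aff_dim A + aff_dim B"
proof -
  obtain a b where ab: "a \<in> A" "b \<in> B" using assms by blast
  let ?A = "(+) (- a) ` A" and ?B = "(+) (- b) ` B"
  have 0: "0 \<in> ?A" "0 \<in> ?B" using ab by force+
  have "(+) (- (a, b)) ` (A \<times> B) = ?A \<times> ?B"
    by (auto simp: image_iff)
  then have "aff_dim (A \<times> B) = int (dim (?A \<times> ?B))"
    using ab by (metis SigmaI aff_dim_eq_dim hull_inc)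
  also have "dim (?A \<times> ?B) = dim (span ?A \<times> span ?B)"
    using span_Times[OF 0] by (metis dim_span)
  also have "\<dots> = dim ?A + dim ?B" by (simp add: eucl.dim_Times)
  finally show ?thesis
    using aff_dim_eq_dim_subtract[OF hull_inc[OF ab(1)]] aff_dim_eq_dim_subtract[OF hull_inc[OF ab(2)]]
    by simp
qed

lemma nat_aff_dim_Times:
  fixes A :: "'a::euclidean_space set" and B :: "'b::euclidean_space set"
  assumes "A \<noteq> {}" "B \<noteq> {}"
  shows "nat (aff_dim (A \<times> B)) = nat (aff_dim A) + nat (aff_dim B)"
proof -
  have "0 \<le> aff_dim A" "0 \<le> aff_dim B" using assms aff_dim_negative_iff by (metis linorder_not_less)+
  then show ?thesis by (simp add: aff_dim_Times[OF assms] nat_add_distrib)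
qed

lemma f_polynomial_injective_linear_image:
  fixes h :: "'a::euclidean_space \<Rightarrow> 'b::euclidean_space"
  assumes "linear h" "inj h"
  shows "f_polynomial (h ` P) = f_polynomial P"
proof -
  have "{F. F face_of h ` P \<and> F \<noteq> {}} = (`) h ` {F. F face_of P \<and> F \<noteq> {}}"
  proof (intro equalityI subsetI)
    fix F assume F: "F \<in> {F. F face_of h ` P \<and> F \<noteq> {}}"
    then obtain G where "F = h ` G" by (metis (lifting) face_of_imp_subset mem_Collect_eq subset_imageE)
    with F show "F \<in> (`) h ` {F. F face_of P \<and> F \<noteq> {}}"
      using assms by (auto simp: face_of_linear_image)
  qed (use assms in \<open>auto simp: face_of_linear_image\<close>)
  moreover have "inj_on ((`) h) {F. F face_of P \<and> F \<noteq> {}}"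
    using assms(2) by (simp add: inj_image_eq_iff inj_on_def)
  ultimately show ?thesis
    unfolding f_polynomial_def using assms by (simp add: sum.reindex)
qed

text \<open>The nonempty faces of \<open>A \<times> B\<close> correspond to the pairs of nonempty faces of \<open>A\<close> and \<open>B\<close>, and dimensions add.\<close>

lemma f_polynomial_Times:
  fixes A :: "'a::euclidean_space set" and B :: "'b::euclidean_space set"
  shows "f_polynomial (A \<times> B) = f_polynomial A * f_polynomial B"
proof -
  let ?faces = "\<lambda>P. {F. F face_of P \<and> F \<noteq> {}}"
  have img: "?faces (A \<times> B) = (\<lambda>(F, G). F \<times> G) ` (?faces A \<times> ?faces B)"
    by (auto simp: face_of_Times_decomp image_iff)
  have "inj_on (\<lambda>(F, G). F \<times> G) (?faces A \<times> ?faces B)"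
    by (auto simp: inj_on_def times_eq_iff)
  then have "f_polynomial (A \<times> B) =
      (\<Sum>(F, G) \<in> ?faces A \<times> ?faces B. monom 1 (nat (aff_dim (F \<times> G))))"
    unfolding f_polynomial_def img by (simp add: sum.reindex case_prod_unfold)
  also have "\<dots> = (\<Sum>(F, G) \<in> ?faces A \<times> ?faces B.
      monom 1 (nat (aff_dim F)) * monom 1 (nat (aff_dim G)))"
    by (intro sum.cong refl) (simp add: nat_aff_dim_Times mult_monom mem_Times_iff case_prod_unfold)
  also have "\<dots> = f_polynomial A * f_polynomial B"
    unfolding f_polynomial_def sum_product by (simp add: sum.cartesian_product)
  finally show ?thesis .
qed

text \<open>The face \<open>P\<close> contributes to the coefficient at its dimension, and coefficients are counts, so nothing cancels.\<close>

lemma degree_f_polynomial_pos: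
  assumes "polytope P" "aff_dim P \<ge> 1"
  shows "degree (f_polynomial P) \<ge> 1"
proof -
  let ?faces = "{F. F face_of P \<and> F \<noteq> {}}"
  have fin: "finite ?faces" using finite_polytope_faces[OF assms(1)] by simp
  have "P \<in> ?faces" using assms by (auto simp: face_of_refl polytope_imp_convex)
  then have "1 \<le> (\<Sum>F\<in>?faces. if nat (aff_dim F) = nat (aff_dim P) then 1 else 0 :: rat)"
    using fin member_le_sum[of P ?faces "\<lambda>F. if nat (aff_dim F) = nat (aff_dim P) then 1 else 0 :: rat"]
    by simp
  then have "coeff (f_polynomial P) (nat (aff_dim P)) \<noteq> 0"
    by (simp add: f_polynomial_def coeff_sum)
  then have "nat (aff_dim P) \<le> degree (f_polynomial P)" by (rule le_degree)
  then show ?thesis using assms(2) by linarith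
qed

section \<open>Lexicographically smallest convex combinations\<close>

text \<open>The ways to write \<open>x\<close> as a nonnegative combination of \<open>p 0, \<dots>, p (N - 1)\<close> of total weight \<open>m\<close>. Weights vanish from \<open>N\<close> on,
  so that equality of weights is equality of functions.\<close>

definition weights :: "nat \<Rightarrow> (nat \<Rightarrow> 'a::real_vector) \<Rightarrow> real \<Rightarrow> 'a \<Rightarrow> (nat \<Rightarrow> real) set" where
  "weights N p m x = {\<mu>. (\<forall>i. 0 \<le> \<mu> i) \<and> (\<forall>i\<ge>N. \<mu> i = 0) \<and>
     (\<Sum>i<N. \<mu> i) = m \<and> (\<Sum>i<N. \<mu> i *\<^sub>R p i) = x}"

definition affine_relation :: "nat \<Rightarrow> (nat \<Rightarrow> 'a::real_vector) \<Rightarrow> (nat \<Rightarrow> real) \<Rightarrow> bool" where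
  "affine_relation N p c \<longleftrightarrow> (\<forall>i\<ge>N. c i = 0) \<and> (\<Sum>i<N. c i) = 0 \<and> (\<Sum>i<N. c i *\<^sub>R p i) = 0"

definition lex_neg :: "(nat \<Rightarrow> real) \<Rightarrow> bool" where
  "lex_neg c \<longleftrightarrow> (\<exists>k. c k < 0 \<and> (\<forall>i<k. c i = 0))"

definition supp :: "(nat \<Rightarrow> real) \<Rightarrow> nat set" where
  "supp \<mu> = {i. \<mu> i \<noteq> 0}"

text \<open>These are the supports of the lexicographically smallest weights. From \<open>\<mu>\<close> one can move a little in the direction of
  a relation \<open>c\<close> and keep the weights nonnegative precisely if \<open>c\<close> is nonnegative outside the support of \<open>\<mu>\<close>. So
  minimality of \<open>\<mu>\<close> is a property of its support alone, and the convex hull is the disjoint union of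
  the open simplices spanned by these sets: a triangulation that is described without geometry.\<close>

definition lex_cell :: "nat \<Rightarrow> (nat \<Rightarrow> 'a::real_vector) \<Rightarrow> nat set \<Rightarrow> bool" where
  "lex_cell N p S \<longleftrightarrow> S \<subseteq> {..<N} \<and>
     (\<forall>c. affine_relation N p c \<and> (\<forall>i. i \<notin> S \<longrightarrow> 0 \<le> c i) \<longrightarrow> \<not> lex_neg c)"

lemma affine_relation_diff:
  assumes "\<mu> \<in> weights N p m x" "\<nu> \<in> weights N p m x"
  shows "affine_relation N p (\<lambda>i. \<nu> i - \<mu> i)"
  using assms by (auto simp: weights_def affine_relation_def sum_subtractf scaleR_diff_left)

lemma lex_neg_total:
  assumes "\<mu> \<noteq> \<nu>"
  shows "lex_neg (\<lambda>i. \<nu> i - \<mu> i) \<or> lex_neg (\<lambda>i. \<mu> i - \<nu> i)"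
proof -
  obtain i where "\<mu> i \<noteq> \<nu> i" using assms by auto
  define k where "k = (LEAST i. \<mu> i \<noteq> \<nu> i)"
  have "\<mu> k \<noteq> \<nu> k" unfolding k_def using \<open>\<mu> i \<noteq> \<nu> i\<close> by (rule LeastI)
  moreover have "\<mu> i = \<nu> i" if "i < k" for i using not_less_Least that unfolding k_def by blast
  ultimately show ?thesis unfolding lex_neg_def by (metis diff_self diff_less_0_iff_less linorder_neqE_linordered_idom)
qed

text \<open>The difference of \<open>\<mu>\<close> and \<open>\<nu>\<close> is an affine relation; taken in either direction it is nonnegative outside the support of
  the weights subtracted, and in one of the directions it is lexicographically negative.\<close>

lemma weights_lex_cell_unique:
  assumes "\<mu> \<in> weights N p m x" "\<nu> \<in> weights N p m x"
    and "lex_cell N p (supp \<mu>)" "lex_cell N p (supp \<nu>)"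
  shows "\<mu> = \<nu>"
proof (rule ccontr)
  assume "\<mu> \<noteq> \<nu>"
  have *: "\<not> lex_neg (\<lambda>i. \<nu> i - \<mu> i)"
    if "\<mu> \<in> weights N p m x" "\<nu> \<in> weights N p m x" "lex_cell N p (supp \<mu>)" for \<mu> \<nu>
  proof -
    have "0 \<le> \<nu> i - \<mu> i" if "i \<notin> supp \<mu>" for i
      using that \<open>\<nu> \<in> _\<close> by (simp add: supp_def weights_def)
    then show ?thesis using that affine_relation_diff[OF that(1,2)] unfolding lex_cell_def by blast
  qed
  show False using lex_neg_total[OF \<open>\<mu> \<noteq> \<nu>\<close>] * assms by blast
qed

text \<open>The coordinates are minimised one after the other, each over the compact set of the minimisers of the earlier ones.\<close>

lemma compact_lex_minimum:
  fixes K :: "(nat \<Rightarrow> real) set"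
  assumes "compact K" "K \<noteq> {}"
  shows "\<exists>\<mu>\<in>K. \<forall>\<nu>\<in>K. \<forall>k<N. (\<forall>i<k. \<nu> i = \<mu> i) \<longrightarrow> \<mu> k \<le> \<nu> k"
proof (induction N)
  case (Suc N)
  then obtain \<mu> where \<mu>: "\<mu> \<in> K" "\<And>\<nu> k. \<nu> \<in> K \<Longrightarrow> k < N \<Longrightarrow> \<forall>i<k. \<nu> i = \<mu> i \<Longrightarrow> \<mu> k \<le> \<nu> k" by blast
  let ?K = "K \<inter> (\<Inter>i<N. {\<nu>. \<nu> i = \<mu> i})"
  have "closed {\<nu>::nat \<Rightarrow> real. \<nu> i = \<mu> i}" for i
    by (intro closed_Collect_eq continuous_on_product_coordinates continuous_on_const)
  then have "compact ?K" using assms by (intro compact_Int_closed closed_INT) auto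
  moreover have "?K \<noteq> {}" using \<mu> by auto
  moreover have "continuous_on ?K (\<lambda>\<nu>. \<nu> N)"
    by (rule continuous_on_subset[OF continuous_on_product_coordinates]) simp
  ultimately obtain \<nu> where \<nu>: "\<nu> \<in> ?K" "\<forall>\<xi>\<in>?K. \<nu> N \<le> \<xi> N"
    using continuous_attains_inf[of ?K "\<lambda>\<nu>. \<nu> N"] by blast
  show ?case
  proof (intro bexI ballI allI impI)
    fix \<xi> k assume \<xi>: "\<xi> \<in> K" "k < Suc N" "\<forall>i<k. \<xi> i = \<nu> i"
    show "\<nu> k \<le> \<xi> k"
    proof (cases "k = N")
      case True
      then have "\<xi> \<in> ?K" using \<xi> \<nu>(1) by simp
      then show ?thesis using \<nu>(2) True by blast
    next
      case False
      then show ?thesis using \<mu>(2)[of \<xi> k] \<xi> \<nu>(1) by simp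
    qed
  qed (use \<nu> in simp)
qed (use assms in auto)

lemma compact_weights: "compact (weights N p m (x :: 'a::real_normed_vector))"
proof -
  let ?B = "PiE UNIV (\<lambda>i::nat. if i < N then {0..m} else {0})"
  have "compactin (product_topology (\<lambda>i. euclidean) UNIV) ?B"
    unfolding compactin_PiE by auto
  then have "compact ?B" by (simp add: euclidean_product_topology compactin_euclidean_iff)
  moreover have "continuous_on UNIV (\<lambda>\<mu>::nat \<Rightarrow> real. \<Sum>i<N. \<mu> i)"
    "continuous_on UNIV (\<lambda>\<mu>::nat \<Rightarrow> real. \<Sum>i<N. \<mu> i *\<^sub>R p i)"
    by (intro continuous_intros continuous_on_product_coordinates)+
  then have "closed {\<mu>::nat \<Rightarrow> real. (\<Sum>i<N. \<mu> i) = m}"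
    "closed {\<mu>::nat \<Rightarrow> real. (\<Sum>i<N. \<mu> i *\<^sub>R p i) = x}"
    by (auto intro!: closed_Collect_eq continuous_on_const)
  ultimately have "compact (?B \<inter> {\<mu>. (\<Sum>i<N. \<mu> i) = m} \<inter> {\<mu>. (\<Sum>i<N. \<mu> i *\<^sub>R p i) = x})"
    by (intro compact_Int_closed)
  also have "?B \<inter> {\<mu>. (\<Sum>i<N. \<mu> i) = m} \<inter> {\<mu>. (\<Sum>i<N. \<mu> i *\<^sub>R p i) = x} = weights N p m x"
  proof -
    have "\<mu> i \<le> m" if "\<forall>i. 0 \<le> \<mu> i" "(\<Sum>i<N. \<mu> i) = m" "i < N" for \<mu> i
      using that member_le_sum[of i "{..<N}" \<mu>] by auto
    then show ?thesis by (auto simp: weights_def PiE_iff split: if_splits) (metis linorder_not_less order_refl)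
  qed
  finally show ?thesis .
qed

text \<open>The lexicographically smallest \<open>\<mu>\<close> works: a lexicographically negative relation that is nonnegative outside its support
  could be added to it in a small multiple \<open>t\<close>.\<close>

lemma weights_lex_cell_exists:
  fixes x :: "'a::real_normed_vector"
  assumes "weights N p m x \<noteq> {}"
  obtains \<mu> where "\<mu> \<in> weights N p m x" "lex_cell N p (supp \<mu>)"
proof -
  obtain \<mu> where \<mu>: "\<mu> \<in> weights N p m x"
    and min: "\<And>\<nu> k. \<nu> \<in> weights N p m x \<Longrightarrow> k < N \<Longrightarrow> \<forall>i<k. \<nu> i = \<mu> i \<Longrightarrow> \<mu> k \<le> \<nu> k"
    using compact_lex_minimum[OF compact_weights assms, of N] by blast
  have sub: "supp \<mu> \<subseteq> {..<N}" using \<mu> by (force simp: supp_def weights_def not_le[symmetric])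
  then have fin: "finite (supp \<mu>)" by (rule finite_subset) simp
  have "\<not> lex_neg c" if c: "affine_relation N p c" "\<forall>i. i \<notin> supp \<mu> \<longrightarrow> 0 \<le> c i" for c
  proof
    assume "lex_neg c"
    then obtain k where k: "c k < 0" "\<forall>i<k. c i = 0" unfolding lex_neg_def by blast
    have "\<forall>i\<in>supp \<mu>. \<exists>e>0. \<forall>t. 0 < t \<and> t < e \<longrightarrow> 0 \<le> \<mu> i + t * c i"
    proof
      fix i assume "i \<in> supp \<mu>"
      then have pos: "0 < \<mu> i" using \<mu> by (simp add: supp_def weights_def order_less_le)
      have "0 \<le> \<mu> i + t * c i" if "0 < t" "t < \<mu> i / (\<bar>c i\<bar> + 1)" for t
      proof -
        have "t * (\<bar>c i\<bar> + 1) < \<mu> i" using that by (simp add: pos_less_divide_eq)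
        moreover have "- (t * c i) \<le> t * \<bar>c i\<bar>" "0 < t"
          using that by (auto simp: abs_if mult_le_0_iff)
        ultimately show ?thesis by (simp add: distrib_left)
      qed
      then show "\<exists>e>0. \<forall>t. 0 < t \<and> t < e \<longrightarrow> 0 \<le> \<mu> i + t * c i"
        using pos by (intro exI[of _ "\<mu> i / (\<bar>c i\<bar> + 1)"]) auto
    qed
    then obtain e where e: "\<And>i. i \<in> supp \<mu> \<Longrightarrow> 0 < e i"
      "\<And>i t. i \<in> supp \<mu> \<Longrightarrow> 0 < t \<Longrightarrow> t < e i \<Longrightarrow> 0 \<le> \<mu> i + t * c i" by metis
    (* Half the smallest bound e i keeps every weight on the support nonnegative. *)
    define t where "t = Min (insert 1 (e ` supp \<mu>)) / 2"
    have "0 < Min (insert 1 (e ` supp \<mu>))" using fin e(1) by (subst Min_gr_iff) auto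
    then have t: "0 < t" "t < Min (insert 1 (e ` supp \<mu>))" by (auto simp: t_def)
    then have te: "t < e i" if "i \<in> supp \<mu>" for i using fin that by auto
    let ?\<nu> = "\<lambda>i. \<mu> i + t * c i"
    have "?\<nu> \<in> weights N p m x"
    proof -
      have "0 \<le> ?\<nu> i" for i
        using e(2)[of i t] t(1) te[of i] c(2) \<mu> by (cases "i \<in> supp \<mu>") (auto simp: weights_def)
      moreover have "(\<Sum>i<N. ?\<nu> i) = m"
        using \<mu> c(1) by (simp add: weights_def affine_relation_def sum.distrib flip: sum_distrib_left)
      moreover have "(\<Sum>i<N. ?\<nu> i *\<^sub>R p i) = (\<Sum>i<N. \<mu> i *\<^sub>R p i) + t *\<^sub>R (\<Sum>i<N. c i *\<^sub>R p i)"
        by (simp add: scaleR_add_left sum.distrib scaleR_sum_right)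
      ultimately show ?thesis using \<mu> c(1) by (auto simp: weights_def affine_relation_def)
    qed
    moreover have "k < N" using k(1) c(1) by (force simp: affine_relation_def not_le[symmetric])
    ultimately have "\<mu> k \<le> \<mu> k + t * c k" using min[of ?\<nu> k] k(2) by simp
    then show False using t(1) k(1) by (simp add: mult_less_0_iff zero_le_mult_iff)
  qed
  then have "lex_cell N p (supp \<mu>)" using sub unfolding lex_cell_def by blast
  with \<mu> show thesis using that by blast
qed

lemma dilated_convex_hull_iff_weights:
  assumes "inj_on p {..<N}" "0 < m"
  shows "x \<in> (\<lambda>x. m *\<^sub>R x) ` (convex hull (p ` {..<N})) \<longleftrightarrow> weights N p m x \<noteq> {}"
proof
  assume "x \<in> (\<lambda>x. m *\<^sub>R x) ` (convex hull (p ` {..<N}))"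
  then obtain u where u: "\<forall>v\<in>p ` {..<N}. 0 \<le> u v" "sum u (p ` {..<N}) = 1"
    "x = m *\<^sub>R (\<Sum>v\<in>p ` {..<N}. u v *\<^sub>R v)" by (auto simp: convex_hull_finite)
  have "(\<lambda>i. if i < N then m * u (p i) else 0) \<in> weights N p m x"
    using u assms by (auto simp: weights_def sum.reindex scaleR_sum_right simp flip: sum_distrib_left)
  then show "weights N p m x \<noteq> {}" by blast
next
  assume "weights N p m x \<noteq> {}"
  then obtain \<mu> where \<mu>: "\<And>i. 0 \<le> \<mu> i" "(\<Sum>i<N. \<mu> i) = m" "(\<Sum>i<N. \<mu> i *\<^sub>R p i) = x"
    by (auto simp: weights_def)
  have "(\<Sum>i<N. (\<mu> i / m) *\<^sub>R p i) \<in> convex hull (p ` {..<N})"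
    using \<mu> assms(2) by (intro convex_sum) (auto simp: hull_inc simp flip: sum_divide_distrib)
  moreover have "x = m *\<^sub>R (\<Sum>i<N. (\<mu> i / m) *\<^sub>R p i)"
    using \<mu>(3) assms(2) by (simp add: scaleR_sum_right)
  ultimately show "x \<in> (\<lambda>x. m *\<^sub>R x) ` (convex hull (p ` {..<N}))" by blast
qed

section \<open>Ehrhart's theorem for lattice polytopes\<close>

lemma finite_bounded_integer_points:
  fixes X :: "(real ^ 'n::finite) set"
  assumes "bounded X"
  shows "finite (X \<inter> integer_points)"
proof -
  obtain B where B: "\<And>x. x \<in> X \<Longrightarrow> norm x \<le> B" using assms by (auto simp: bounded_iff)
  have "finite (PiE (UNIV :: 'n set) (\<lambda>_. {k\<in>\<int>. \<bar>k\<bar> \<le> B}))"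
    by (intro finite_PiE finite_abs_int_segment finite)
  moreover have "X \<inter> integer_points \<subseteq> vec_lambda ` (PiE UNIV (\<lambda>_. {k\<in>\<int>. \<bar>k\<bar> \<le> B}))"
  proof
    fix x assume x: "x \<in> X \<inter> integer_points"
    then have "vec_nth x \<in> PiE UNIV (\<lambda>_. {k\<in>\<int>. \<bar>k\<bar> \<le> B})"
      using order_trans[OF component_le_norm_cart B] by (simp add: integer_points_def PiE_iff)
    then show "x \<in> vec_lambda ` (PiE UNIV (\<lambda>_. {k\<in>\<int>. \<bar>k\<bar> \<le> B}))"
      by (rule image_eqI[rotated]) (simp add: vec_nth_inverse)
  qed
  ultimately show ?thesis using finite_subset finite_imageI by blast
qed

lemma integer_points_add: "x \<in> integer_points \<Longrightarrow> y \<in> integer_points \<Longrightarrow> x + y \<in> integer_points"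
  by (simp add: integer_points_def)

lemma integer_points_diff: "x \<in> integer_points \<Longrightarrow> y \<in> integer_points \<Longrightarrow> x - y \<in> integer_points"
  by (simp add: integer_points_def)

lemma integer_points_sum_of_nat:
  fixes p :: "nat \<Rightarrow> real ^ 'n::finite"
  assumes "\<And>i. i < N \<Longrightarrow> p i \<in> integer_points"
  shows "(\<Sum>i<N. of_nat (k i) *\<^sub>R p i) \<in> integer_points"
  using assms by (auto simp: integer_points_def intro!: Ints_sum Ints_mult)

definition cell_points :: "nat \<Rightarrow> (nat \<Rightarrow> real ^ 'n::finite) \<Rightarrow> nat set \<Rightarrow> real \<Rightarrow> (nat \<Rightarrow> real) set" where
  "cell_points N p S m = {\<mu>. (\<forall>i. 0 \<le> \<mu> i) \<and> supp \<mu> = S \<and> (\<Sum>i<N. \<mu> i) = m \<and>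
     (\<Sum>i<N. \<mu> i *\<^sub>R p i) \<in> integer_points}"

text \<open>Each lattice point of the dilate has exactly one lexicographically smallest weight function.\<close>

lemma cell_points_bij:
  assumes "inj_on p {..<N}" "0 < m"
  shows "bij_betw (\<lambda>\<mu>. \<Sum>i<N. \<mu> i *\<^sub>R p i) (\<Union>S\<in>{S. lex_cell N p S}. cell_points N p S m)
    ((\<lambda>x. m *\<^sub>R x) ` (convex hull (p ` {..<N})) \<inter> integer_points)"
proof (rule bij_betwI')
  let ?U = "\<Union>S\<in>{S. lex_cell N p S}. cell_points N p S m"
  have U: "\<mu> \<in> ?U \<longleftrightarrow> lex_cell N p (supp \<mu>) \<and> \<mu> \<in> weights N p m (\<Sum>i<N. \<mu> i *\<^sub>R p i) \<and>
      (\<Sum>i<N. \<mu> i *\<^sub>R p i) \<in> integer_points" for \<mu>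
    by (auto simp: cell_points_def weights_def lex_cell_def supp_def)
  fix \<mu> assume \<mu>: "\<mu> \<in> ?U"
  show "(\<Sum>i<N. \<mu> i *\<^sub>R p i) \<in> (\<lambda>x. m *\<^sub>R x) ` (convex hull (p ` {..<N})) \<inter> integer_points"
    using \<mu> unfolding U dilated_convex_hull_iff_weights[OF assms] Int_iff by blast
  fix \<nu> assume \<nu>: "\<nu> \<in> ?U"
  show "(\<Sum>i<N. \<mu> i *\<^sub>R p i) = (\<Sum>i<N. \<nu> i *\<^sub>R p i) \<longleftrightarrow> \<mu> = \<nu>"
    using \<mu> \<nu> weights_lex_cell_unique unfolding U by metis
next
  fix x assume "x \<in> (\<lambda>x. m *\<^sub>R x) ` (convex hull (p ` {..<N})) \<inter> integer_points"
  then have "weights N p m x \<noteq> {}" and x: "x \<in> integer_points"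
    using dilated_convex_hull_iff_weights[OF assms] by blast+
  then obtain \<mu> where "\<mu> \<in> weights N p m x" "lex_cell N p (supp \<mu>)"
    by (metis weights_lex_cell_exists)
  with x show "\<exists>\<mu>\<in>\<Union>S\<in>{S. lex_cell N p S}. cell_points N p S m. x = (\<Sum>i<N. \<mu> i *\<^sub>R p i)"
    by (intro bexI[of _ \<mu>]) (auto simp: weights_def cell_points_def)
qed

lemma finite_cell_points:
  assumes "inj_on p {..<N}" "lex_cell N p S" "0 < m"
  shows "finite (cell_points N p S m)"
proof -
  have "bounded ((\<lambda>x. m *\<^sub>R x) ` (convex hull (p ` {..<N})))"
    by (simp add: bounded_scaling bounded_convex_hull finite_imp_bounded)
  then have "finite (\<Union>S\<in>{S. lex_cell N p S}. cell_points N p S m)"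
    using finite_bounded_integer_points bij_betw_finite[OF cell_points_bij[OF assms(1,3)]] by blast
  then show ?thesis by (rule finite_subset[rotated]) (use assms(2) in blast)
qed

text \<open>Stars and bars for functions, transferred from lists by enumerating \<open>S\<close>.\<close>

lemma card_nat_compositions:
  assumes "finite S"
  shows "card {k :: 'a \<Rightarrow> nat. (\<forall>i. i \<notin> S \<longrightarrow> k i = 0) \<and> sum k S = n} = (n + card S - 1) choose n"
proof -
  obtain xs where xs: "set xs = S" "distinct xs" using finite_distinct_list[OF assms] by blast
  have len: "length xs = card S" by (simp only: xs(1)[symmetric] distinct_card[OF xs(2)])
  let ?K = "{k :: 'a \<Rightarrow> nat. (\<forall>i. i \<notin> S \<longrightarrow> k i = 0) \<and> sum k S = n}"
  have "bij_betw (\<lambda>k. map k xs) ?K {l. length l = card S \<and> sum_list l = n}"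
  proof (rule bij_betwI')
    fix k k' assume "k \<in> ?K" "k' \<in> ?K"
    then have off: "k i = k' i" if "i \<notin> S" for i using that by simp
    show "map k xs = map k' xs \<longleftrightarrow> k = k'"
    proof
      assume "map k xs = map k' xs"
      then have on: "k i = k' i" if "i \<in> S" for i using that xs(1) by (simp add: map_eq_conv)
      show "k = k'" using on off by blast
    qed simp
  next
    fix k assume "k \<in> ?K"
    then show "map k xs \<in> {l. length l = card S \<and> sum_list l = n}"
      using xs len by (simp add: sum_list_distinct_conv_sum_set)
  next
    fix l :: "nat list" assume l: "l \<in> {l. length l = card S \<and> sum_list l = n}"
    define k where "k i = (case map_of (zip xs l) i of None \<Rightarrow> 0 | Some v \<Rightarrow> v)" for i
    have ll: "length xs = length l" using l len by simp
    have m: "map k xs = l"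
    proof (rule nth_equalityI)
      fix j assume "j < length (map k xs)"
      then show "map k xs ! j = l ! j"
        using ll xs(2) by (simp add: k_def map_of_zip_nth)
    qed (simp add: ll)
    moreover have "k i = 0" if "i \<notin> S" for i
      using that xs(1) ll by (simp add: k_def split: option.split) (metis map_of_zip_is_None option.distinct(1))
    moreover have "sum k S = n" using l m xs sum_list_distinct_conv_sum_set[of xs k] by simp
    ultimately show "\<exists>k\<in>?K. l = map k xs" by (intro bexI[of _ k]) auto
  qed
  then show ?thesis by (simp add: bij_betw_same_card card_length_sum_list)
qed

text \<open>Besides the range \<open>j \<le> m\<close> this covers \<open>m < j \<le> m + d\<close>, where both sides vanish. This extra range is what makes the counting
  function a polynomial from \<open>m = 1\<close> on, and not only for large \<open>m\<close>.\<close>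

lemma binomial_polynomial:
  obtains q :: "rat poly" where
    "\<And>m. j \<le> m + d \<Longrightarrow> poly q (of_nat m) = of_nat ((m + d - j) choose d)"
proof
  let ?q = "smult (1 / fact d) (\<Prod>i<d. [:of_nat d - of_nat j - of_nat i, 1:]) :: rat poly"
  fix m assume "j \<le> m + d"
  have "poly ?q (of_nat m) = (\<Prod>i<d. of_nat m + of_nat d - of_nat j - of_nat i) / fact d"
    by (simp add: poly_prod algebra_simps)
  also have "\<dots> = (of_nat (m + d - j) :: rat) gchoose d"
    using \<open>j \<le> m + d\<close> by (simp add: gbinomial_prod_rev of_nat_diff lessThan_atLeast0)
  finally show "poly ?q (of_nat m) = of_nat ((m + d - j) choose d)"
    by (simp add: binomial_gbinomial)
qed

text \<open>The support condition in \<open>cell_points\<close> makes the weights on \<open>S\<close> positive, so they lie in \<open>(0, 1]\<close>: these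
  are the points of the fundamental parallelepiped of the cone over \<open>S\<close>, at height \<open>j\<close>.\<close>

definition box_points :: "nat \<Rightarrow> (nat \<Rightarrow> real ^ 'n::finite) \<Rightarrow> nat set \<Rightarrow> nat \<Rightarrow> (nat \<Rightarrow> real) set" where
  "box_points N p S j = {f \<in> cell_points N p S (real j). \<forall>i. f i \<le> 1}"

text \<open>A positive weight is uniquely a number in \<open>(0, 1]\<close> plus a natural number. Natural combinations of lattice points
  are lattice points, so the fractional part of a weight function in \<open>cell_points\<close> is one in \<open>box_points\<close>. Its height \<open>j\<close>
  is a natural number between 1 and \<open>card S\<close>.\<close>

lemma cell_points_decomposition:
  assumes p: "\<And>i. i < N \<Longrightarrow> p i \<in> integer_points" and S: "S \<subseteq> {..<N}" and m: "1 \<le> m"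
  shows "bij_betw (\<lambda>((j, f), k). \<lambda>i. f i + real (k i))
     (SIGMA (j, f):(SIGMA j:{1..card S}. box_points N p S j).
        {k. (\<forall>i. i \<notin> S \<longrightarrow> k i = 0) \<and> sum k S + j = m})
     (cell_points N p S (real m))"
    (is "bij_betw ?h ?D _")
proof -
  have fS: "finite S" using S finite_subset by blast
  have sumS: "(\<Sum>i<N. g i) = sum g S" if "\<And>i. i \<notin> S \<Longrightarrow> g i = 0" for g :: "nat \<Rightarrow> real"
    using that S by (intro sum.mono_neutral_right) auto
  have int_k: "(\<Sum>i<N. real (k i) *\<^sub>R p i) \<in> integer_points" for k
    by (rule integer_points_sum_of_nat) (rule p)
  have D: "x \<in> ?D \<longleftrightarrow> (\<exists>j f k. x = ((j, f), k) \<and> 1 \<le> j \<and> j \<le> card S \<and> f \<in> box_points N p S j \<and>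
      (\<forall>i. i \<notin> S \<longrightarrow> k i = 0) \<and> sum k S + j = m)" for x
    by (cases x) auto
  show ?thesis
  proof (rule bij_betwI')
    fix x y assume "x \<in> ?D" "y \<in> ?D"
    then obtain j f k j' f' k' where x: "x = ((j, f), k)" "f \<in> box_points N p S j"
        "\<forall>i. i \<notin> S \<longrightarrow> k i = 0"
      and y: "y = ((j', f'), k')" "f' \<in> box_points N p S j'" "\<forall>i. i \<notin> S \<longrightarrow> k' i = 0"
      unfolding D by blast
    have "x = y" if eq: "?h x = ?h y"
    proof -
      have sum_eq: "f i + real (k i) = f' i + real (k' i)" for i
        using fun_cong[OF eq, of i] x y by simp
      have k: "k i = k' i" for i
      proof (cases "i \<in> S")
        case True
        then have "0 < f i" "f i \<le> 1" "0 < f' i" "f' i \<le> 1"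
          using x(2) y(2) by (auto simp: box_points_def cell_points_def supp_def order_less_le)
        then have "\<bar>real (k i) - real (k' i)\<bar> < 1" using sum_eq[of i] by linarith
        then show ?thesis by linarith
      qed (use x y in simp)
      then have f: "f = f'" using sum_eq by (auto simp: fun_eq_iff)
      then have "real j = real j'" using x(2) y(2) by (auto simp: box_points_def cell_points_def)
      with k f show ?thesis using x(1) y(1) by (simp add: fun_eq_iff)
    qed
    then show "?h x = ?h y \<longleftrightarrow> x = y" by blast
  next
    fix x assume "x \<in> ?D"
    then obtain j f k where x: "x = ((j, f), k)" and f: "f \<in> box_points N p S j"
      and k: "\<And>i. i \<notin> S \<Longrightarrow> k i = 0" "sum k S + j = m"
      unfolding D by blast
    have "f i + real (k i) \<noteq> 0 \<longleftrightarrow> i \<in> S" for i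
      using f k(1)[of i]
      by (cases "i \<in> S") (auto simp: box_points_def cell_points_def supp_def add_nonneg_eq_0_iff)
    moreover have "(\<Sum>i<N. f i + real (k i)) = real m"
    proof -
      have "(\<Sum>i<N. real (k i)) = real (sum k S)" using sumS[of "\<lambda>i. real (k i)"] k(1) by simp
      moreover have "(\<Sum>i<N. f i) = real j" using f by (simp add: box_points_def cell_points_def)
      moreover have "real (sum k S) + real j = real m" by (simp only: k(2) flip: of_nat_add)
      ultimately show ?thesis by (simp add: sum.distrib)
    qed
    moreover have "(\<Sum>i<N. (f i + real (k i)) *\<^sub>R p i) \<in> integer_points"
      using f integer_points_add[OF _ int_k[of k]]
      by (simp add: scaleR_add_left sum.distrib box_points_def cell_points_def)
    ultimately show "?h x \<in> cell_points N p S (real m)"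
      using f x by (auto simp: cell_points_def supp_def box_points_def)
  next
    fix \<mu> assume \<mu>: "\<mu> \<in> cell_points N p S (real m)"
    then have supp: "0 \<le> \<mu> i" "\<mu> i \<noteq> 0 \<longleftrightarrow> i \<in> S" for i by (auto simp: cell_points_def supp_def)
    (* Rounding up and subtracting 1 sends a positive integer to its predecessor, which leaves the part 1;
       off S it gives nat (-1) = 0. *)
    define k where "k i = nat (\<lceil>\<mu> i\<rceil> - 1)" for i
    define f where "f i = \<mu> i - real (k i)" for i
    have off: "k i = 0" "f i = 0" if "i \<notin> S" for i
      using that supp(2)[of i] by (simp_all add: k_def f_def)
    have on: "0 < f i" "f i \<le> 1" if "i \<in> S" for i
    proof -
      have "0 < \<mu> i" using supp[of i] that by simp
      then have "1 \<le> \<lceil>\<mu> i\<rceil>" by linarith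
      then have "real (k i) = of_int \<lceil>\<mu> i\<rceil> - 1" by (simp add: k_def)
      then show "0 < f i" "f i \<le> 1" unfolding f_def by linarith+
    qed
    have f01: "0 \<le> f i" "f i \<le> 1" for i using on[of i] off[of i] by (cases "i \<in> S"; simp)+
    have "(\<Sum>i<N. \<mu> i) = sum \<mu> S" by (rule sumS) (use supp(2) in blast)
    then have sum_\<mu>: "sum \<mu> S = real m" using \<mu> by (simp add: cell_points_def)
    then have sum_f: "sum f S = real m - real (sum k S)" by (simp add: f_def sum_subtractf)
    have "S \<noteq> {}" using sum_\<mu> m by auto
    then have "0 < sum f S" using fS on by (intro sum_pos) auto
    moreover have "sum f S \<le> real (card S)"
      using sum_bounded_above[of S f 1] f01 by simp
    ultimately have j: "sum k S < m" "m - sum k S \<le> card S" using sum_f by linarith+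
    let ?j = "m - sum k S"
    have "f \<in> box_points N p S ?j"
    proof -
      have "(\<Sum>i<N. f i) = real ?j" using sumS[of f] off(2) sum_f j by (simp add: of_nat_diff)
      moreover have "(\<Sum>i<N. f i *\<^sub>R p i) \<in> integer_points"
        using \<mu> integer_points_diff[OF _ int_k[of k]]
        by (simp add: f_def scaleR_diff_left sum_subtractf cell_points_def)
      moreover have "supp f = S" using on off by (force simp: supp_def)
      ultimately show ?thesis using f01 by (simp add: box_points_def cell_points_def)
    qed
    then have "((?j, f), k) \<in> ?D" using j off(1) unfolding D by auto
    moreover have "\<mu> = ?h ((?j, f), k)" by (simp add: f_def)
    ultimately show "\<exists>x\<in>?D. \<mu> = ?h x" by blast
  qed
qed

lemma card_cell_points:
  assumes inj: "inj_on p {..<N}" and p: "\<And>i. i < N \<Longrightarrow> p i \<in> integer_points"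
    and S: "lex_cell N p S" and m: "1 \<le> m"
  shows "card (cell_points N p S (real m)) =
    (\<Sum>j\<in>{1..card S}. card (box_points N p S j) * ((m + (card S - 1) - j) choose (card S - 1)))"
proof -
  have S': "S \<subseteq> {..<N}" using S by (simp add: lex_cell_def)
  then have fS: "finite S" using finite_subset by blast
  let ?K = "\<lambda>j. {k. (\<forall>i. i \<notin> S \<longrightarrow> k i = 0) \<and> sum k S + j = m}"
  have cardK: "card (?K j) = (m + (card S - 1) - j) choose (card S - 1) \<and> finite (?K j)"
    if j: "1 \<le> j" "j \<le> card S" for j
  proof (cases "j \<le> m")
    case True
    then have "?K j = {k. (\<forall>i. i \<notin> S \<longrightarrow> k i = 0) \<and> sum k S = m - j}" by auto
    moreover have "(m - j + card S - 1) choose (m - j) = (m + (card S - 1) - j) choose (card S - 1)"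
      using True j by (subst binomial_symmetric) (auto intro: arg_cong2[where f = binomial])
    ultimately have "card (?K j) = (m + (card S - 1) - j) choose (card S - 1)"
      using card_nat_compositions[OF fS, of "m - j"] by simp
    moreover from this have "0 < card (?K j)" using True by simp
    then have "finite (?K j)" by (rule card_ge_0_finite)
    ultimately show ?thesis by blast
  next
    case False
    then have empty: "?K j = {}" by auto
    have "m + (card S - 1) - j < card S - 1" using False j m by linarith
    then show ?thesis unfolding empty by (simp add: binomial_eq_0)
  qed
  have fin: "finite (box_points N p S j)" if "1 \<le> j" for j
    using finite_cell_points[OF inj S, of "real j"] that by (simp add: box_points_def)
  have "card (cell_points N p S (real m)) =
      card (SIGMA (j, f):(SIGMA j:{1..card S}. box_points N p S j). ?K j)"
    using bij_betw_same_card[OF cell_points_decomposition[OF p S' m]] by simp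
  also have "\<dots> = (\<Sum>(j, f)\<in>(SIGMA j:{1..card S}. box_points N p S j). card (?K j))"
    using fin cardK by (subst card_SigmaI) (auto simp: case_prod_unfold)
  also have "\<dots> = (\<Sum>j\<in>{1..card S}. \<Sum>f\<in>box_points N p S j. card (?K j))"
    using fin by (subst sum.Sigma) auto
  also have "\<dots> = (\<Sum>j\<in>{1..card S}. card (box_points N p S j) * ((m + (card S - 1) - j) choose (card S - 1)))"
  proof (rule sum.cong[OF refl])
    fix j assume "j \<in> {1..card S}"
    then have "1 \<le> j" "j \<le> card S" by simp_all
    from cardK[OF this, THEN conjunct1]
    show "(\<Sum>f\<in>box_points N p S j. card (?K j)) =
        card (box_points N p S j) * ((m + (card S - 1) - j) choose (card S - 1))"
      by (simp only: sum_constant of_nat_id)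
  qed
  finally show ?thesis .
qed

theorem ehrhart_polynomial_exists:
  fixes V :: "(real ^ 'n::finite) set"
  assumes "finite V" "V \<subseteq> integer_points"
  obtains q :: "rat poly" where "\<And>m::nat. 1 \<le> m \<Longrightarrow>
    poly q (of_nat m) = of_nat (card ((\<lambda>x. real m *\<^sub>R x) ` (convex hull V) \<inter> integer_points))"
proof -
  obtain N :: nat and p where "V = p ` {i. i < N}" "inj_on p {i. i < N}"
    using finite_imp_nat_seg_image_inj_on[OF assms(1)] by blast
  then have V: "V = p ` {..<N}" and inj: "inj_on p {..<N}" by (simp_all add: lessThan_def)
  have p: "p i \<in> integer_points" if "i < N" for i using that V assms(2) by blast
  have "\<exists>q :: rat poly. \<forall>m\<ge>1. poly q (of_nat m) = of_nat (card (cell_points N p S (real m)))"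
    if S: "lex_cell N p S" for S
  proof -
    let ?d = "card S - 1"
    have "\<exists>q :: rat poly. \<forall>m. j \<le> m + ?d \<longrightarrow> poly q (of_nat m) = of_nat ((m + ?d - j) choose ?d)" for j
      using binomial_polynomial[of j ?d] by metis
    then obtain q :: "nat \<Rightarrow> rat poly" where
      q: "\<And>j m. j \<le> m + ?d \<Longrightarrow> poly (q j) (of_nat m) = of_nat ((m + ?d - j) choose ?d)" by metis
    have "poly (\<Sum>j\<in>{1..card S}. of_nat (card (box_points N p S j)) * q j) (of_nat m) =
        of_nat (card (cell_points N p S (real m)))" if "1 \<le> m" for m
    proof -
      have "poly (of_nat (card (box_points N p S j)) * q j) (of_nat m) =
          of_nat (card (box_points N p S j) * ((m + ?d - j) choose ?d))" if "j \<in> {1..card S}" for j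
      proof -
        have "j \<le> m + ?d" using that \<open>1 \<le> m\<close> by auto
        then show ?thesis using q by simp
      qed
      moreover have "card (cell_points N p S (real m)) =
          (\<Sum>j\<in>{1..card S}. card (box_points N p S j) * ((m + ?d - j) choose ?d))"
        by (rule card_cell_points[OF inj _ S that]) (rule p)
      ultimately show ?thesis by (simp only: poly_sum of_nat_sum cong: sum.cong)
    qed
    then show ?thesis by blast
  qed
  then obtain q :: "nat set \<Rightarrow> rat poly" where q: "\<And>S m. lex_cell N p S \<Longrightarrow> 1 \<le> m \<Longrightarrow>
      poly (q S) (of_nat m) = of_nat (card (cell_points N p S (real m)))" by metis
  show thesis
  proof
    fix m :: nat assume m: "1 \<le> m"
    have fin: "finite {S. lex_cell N p S}"
      by (rule finite_subset[of _ "Pow {..<N}"]) (auto simp: lex_cell_def)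
    have "card ((\<lambda>x. real m *\<^sub>R x) ` (convex hull V) \<inter> integer_points) =
        card (\<Union>S\<in>{S. lex_cell N p S}. cell_points N p S (real m))"
      using bij_betw_same_card[OF cell_points_bij[OF inj, of "real m"]] m V by simp
    also have "\<dots> = (\<Sum>S\<in>{S. lex_cell N p S}. card (cell_points N p S (real m)))"
      using fin finite_cell_points[OF inj] m
      by (intro card_UN_disjoint) (auto simp: cell_points_def)
    finally show "poly (\<Sum>S\<in>{S. lex_cell N p S}. q S) (of_nat m) =
        of_nat (card ((\<lambda>x. real m *\<^sub>R x) ` (convex hull V) \<inter> integer_points))"
      using q m by (simp add: poly_sum)
  qed
qed

lemma poly_eqI_positive_nats:
  fixes q r :: "rat poly"
  assumes "\<And>m::nat. 1 \<le> m \<Longrightarrow> poly q (of_nat m) = poly r (of_nat m)"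
  shows "q = r"
proof (rule ccontr)
  assume "q \<noteq> r"
  then have "finite {x. poly (q - r) x = 0}" by (intro poly_roots_finite) simp
  moreover have "of_nat ` {1..} \<subseteq> {x. poly (q - r) x = 0}" using assms by auto
  moreover have "infinite (of_nat ` {1::nat..} :: rat set)"
    by (simp add: finite_image_iff infinite_Ici inj_on_def)
  ultimately show False by (meson finite_subset)
qed

lemma poly_ehrhart_polynomial:
  fixes V :: "(real ^ 'n::finite) set"
  assumes "finite V" "V \<subseteq> integer_points" "1 \<le> m"
  shows "poly (ehrhart_polynomial (convex hull V)) (of_nat m) =
    of_nat (card ((\<lambda>x. real m *\<^sub>R x) ` (convex hull V) \<inter> integer_points))"
proof -
  have "\<exists>!q :: rat poly. \<forall>m\<ge>1. poly q (of_nat m) =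
      of_nat (card ((\<lambda>x. real m *\<^sub>R x) ` (convex hull V) \<inter> integer_points))"
    by (rule ehrhart_polynomial_exists[OF assms(1,2)]) (auto intro!: ex1I poly_eqI_positive_nats)
  from theI'[OF this] assms(3) show ?thesis unfolding ehrhart_polynomial_def by blast
qed

text \<open>The segment from \<open>u\<close> to \<open>v\<close> dilated by \<open>m\<close> contains the \<open>m + 1\<close> lattice points \<open>(m - k) u + k v\<close>, so the counting function is
  unbounded.\<close>

lemma degree_ehrhart_polynomial_pos:
  fixes V :: "(real ^ 'n::finite) set"
  assumes V: "finite V" "V \<subseteq> integer_points" and uv: "u \<in> V" "v \<in> V" "u \<noteq> v"
  shows "degree (ehrhart_polynomial (convex hull V)) \<ge> 1"
proof (rule ccontr)
  let ?L = "\<lambda>m::nat. (\<lambda>x. real m *\<^sub>R x) ` (convex hull V) \<inter> integer_points"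
  assume "\<not> ?thesis"
  then obtain c where c: "ehrhart_polynomial (convex hull V) = [:c:]"
    by (metis degree_eq_zeroE less_one linorder_not_le)
  have "real (m + 1) \<le> card (?L m)" if m: "1 \<le> m" for m
  proof -
    define w where "w k = real (m - k) *\<^sub>R u + real k *\<^sub>R v" for k
    have "inj_on w {..m}"
    proof (rule inj_onI)
      fix k l assume kl: "k \<in> {..m}" "l \<in> {..m}" "w k = w l"
      then have "(real k - real l) *\<^sub>R (v - u) = 0"
        by (simp add: w_def of_nat_diff algebra_simps)
      then show "k = l" using uv(3) by simp
    qed
    moreover have "w ` {..m} \<subseteq> ?L m"
    proof
      fix x assume "x \<in> w ` {..m}"
      then obtain k where k: "k \<le> m" "x = w k" by auto
      have "(1 - real k / real m) *\<^sub>R u + (real k / real m) *\<^sub>R v \<in> convex hull V"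
        using k m uv by (intro convexD convex_convex_hull hull_inc) (auto simp: divide_le_eq)
      moreover have "x = real m *\<^sub>R ((1 - real k / real m) *\<^sub>R u + (real k / real m) *\<^sub>R v)"
        using k m by (simp add: w_def of_nat_diff scaleR_add_right right_diff_distrib)
      moreover have "x \<in> integer_points"
        using k uv V(2) by (auto simp: w_def integer_points_def subset_iff intro!: Ints_add Ints_mult)
      ultimately show "x \<in> ?L m" by blast
    qed
    moreover have "finite (?L m)"
      using V(1) by (intro finite_bounded_integer_points bounded_scaling bounded_convex_hull finite_imp_bounded)
    ultimately have "card {..m} \<le> card (?L m)" by (metis card_image card_mono)
    then show ?thesis by simp
  qed
  moreover have "rat_of_nat (card (?L m)) = c" if "1 \<le> m" for m
    using poly_ehrhart_polynomial[OF V that] c by simp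
  then have "card (?L m) = card (?L 1)" if "1 \<le> m" for m
    using that by (metis of_nat_eq_iff order_refl)
  ultimately have "real (m + 1) \<le> card (?L 1)" if "1 \<le> m" for m using that by metis
  from this[of "card (?L 1) + 1"] show False by simp
qed

lemma card_integer_points_coordinate_split:
  fixes P :: "(real ^ 'n::finite) set"
  assumes "\<And>x y. x \<in> P \<Longrightarrow> y \<in> P \<Longrightarrow> coord_proj I x + coord_proj (- I) y \<in> P"
  shows "card ((\<lambda>x. c *\<^sub>R x) ` P \<inter> integer_points) =
    card ((\<lambda>x. c *\<^sub>R x) ` coord_proj I ` P \<inter> integer_points) *
    card ((\<lambda>x. c *\<^sub>R x) ` coord_proj (- I) ` P \<inter> integer_points)"
proof -
  have scale: "coord_proj J (c *\<^sub>R x) = c *\<^sub>R coord_proj J x" for J and x :: "real ^ 'n"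
    by (simp add: vec_eq_iff)
  have "bij_betw (\<lambda>x. (coord_proj I x, coord_proj (- I) x))
      ((\<lambda>x. c *\<^sub>R x) ` P \<inter> integer_points)
      (((\<lambda>x. c *\<^sub>R x) ` coord_proj I ` P \<inter> integer_points) \<times>
       ((\<lambda>x. c *\<^sub>R x) ` coord_proj (- I) ` P \<inter> integer_points))"
    (is "bij_betw ?h ?L (?A \<times> ?B)")
  proof (rule bij_betwI')
    fix x y :: "real ^ 'n"
    show "?h x = ?h y \<longleftrightarrow> x = y" by (auto simp: vec_eq_iff)
  next
    fix x assume "x \<in> ?L"
    then show "?h x \<in> ?A \<times> ?B" by (auto simp: scale integer_points_def)
  next
    fix z assume "z \<in> ?A \<times> ?B"
    then obtain x y where z: "z = (c *\<^sub>R coord_proj I x, c *\<^sub>R coord_proj (- I) y)" "x \<in> P" "y \<in> P"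
      "c *\<^sub>R coord_proj I x \<in> integer_points" "c *\<^sub>R coord_proj (- I) y \<in> integer_points" by blast
    let ?w = "c *\<^sub>R (coord_proj I x + coord_proj (- I) y)"
    have "?w \<in> integer_points" using integer_points_add[OF z(4,5)] by (simp add: scaleR_add_right)
    then have "?w \<in> ?L" using assms[OF z(2,3)] by blast
    moreover have "z = ?h ?w" unfolding z(1) by (simp add: vec_eq_iff)
    ultimately show "\<exists>w\<in>?L. z = ?h w" by (rule bexI[rotated])
  qed
  then show ?thesis unfolding card_cartesian_product[symmetric] by (rule bij_betw_same_card)
qed

section \<open>Decomposable 0/1-polytopes\<close>

lemma not_irreducible_mult:
  fixes p q :: "'a::field poly"
  assumes "degree p \<ge> 1" "degree q \<ge> 1"
  shows "\<not> irreducible (p * q)"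
proof -
  have "p \<noteq> 0" "q \<noteq> 0" using assms by auto
  then show ?thesis using assms by (auto dest!: irreducible_multD simp: is_unit_iff_degree)
qed

theorem corollary1p2:
  fixes P :: "(real ^ 'n::finite) set"
  assumes "zero_one_polytope P"
    and "full_dimensional P"
    and "irreducible (f_polynomial P)
       \<or> irreducible (ehrhart_polynomial P)
       \<or> coordinate_graph_connected P"
  shows "indecomposable P"
proof
  assume "decomposable P"
  obtain I i j where ij: "i \<in> I" "j \<notin> I"
    and split: "\<And>a. facet_normal P a \<Longrightarrow> (\<forall>k. k \<notin> I \<longrightarrow> a $ k = 0) \<or> (\<forall>k\<in>I. a $ k = 0)"
    by (rule decomposable_facet_normals_split[OF assms(1,2) \<open>decomposable P\<close>]) (rule that)
  have poly: "polytope P" using assms(1) by (simp add: zero_one_polytope_def)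
  have mixed: "coord_proj I x + coord_proj (- I) y \<in> P" if "x \<in> P" "y \<in> P" for x y
    by (rule mixed_point_mem[OF poly assms(2) _ that]) (rule split)
  let ?A = "coord_proj I ` P" and ?B = "coord_proj (- I) ` P"
  obtain V u v where V: "finite V" "V \<subseteq> integer_points" "?A = convex hull V" "u \<in> V" "v \<in> V" "u \<noteq> v"
    by (rule zero_one_polytope_coord_proj[OF assms(1,2) ij(1)]) (rule that)
  have "j \<in> - I" using ij by simp
  obtain W s t where W: "finite W" "W \<subseteq> integer_points" "?B = convex hull W" "s \<in> W" "t \<in> W" "s \<noteq> t"
    by (rule zero_one_polytope_coord_proj[OF assms(1,2) \<open>j \<in> - I\<close>]) (rule that)
  have "\<not> irreducible (f_polynomial P)"
  proof -
    (* Separating the two groups of coordinates embeds P linearly as a Cartesian product. *)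
    let ?h = "\<lambda>x::real ^ 'n. (coord_proj I x, coord_proj (- I) x)"
    have "linear ?h" by (auto intro!: linearI simp: vec_eq_iff)
    moreover have "inj ?h" by (auto simp: inj_def vec_eq_iff)
    moreover have "?h ` P = ?A \<times> ?B"
    proof (intro equalityI subsetI)
      fix z assume "z \<in> ?A \<times> ?B"
      then obtain x y where z: "z = (coord_proj I x, coord_proj (- I) y)" "x \<in> P" "y \<in> P" by blast
      have "z = ?h (coord_proj I x + coord_proj (- I) y)" unfolding z(1) by (simp add: vec_eq_iff)
      then show "z \<in> ?h ` P" using mixed z by blast
    qed auto
    ultimately have "f_polynomial P = f_polynomial ?A * f_polynomial ?B"
      using f_polynomial_injective_linear_image[of ?h P] by (simp only: f_polynomial_Times)
    moreover have "degree (f_polynomial (convex hull X)) \<ge> 1"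
      if "finite X" "x \<in> X" "y \<in> X" "x \<noteq> y" for X and x y :: "real ^ 'n"
    proof (rule degree_f_polynomial_pos)
      show "polytope (convex hull X)" using that by (simp add: polytope_convex_hull)
      have "aff_dim {x, y} \<le> aff_dim (convex hull X)"
        using that by (intro aff_dim_subset) (auto intro: hull_inc)
      then show "1 \<le> aff_dim (convex hull X)" using that by (simp add: aff_dim_2)
    qed
    from this[OF V(1,4,5,6)] this[OF W(1,4,5,6)]
    have "\<not> irreducible (f_polynomial ?A * f_polynomial ?B)"
      unfolding V(3) W(3) by (rule not_irreducible_mult)
    ultimately show ?thesis by simp
  qed
  moreover have "\<not> irreducible (ehrhart_polynomial P)"
  proof -
    note P = zero_one_polytope_convex_hull[OF assms(1)] zero_one_polytope_vertices[OF assms(1)]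
    have "ehrhart_polynomial P = ehrhart_polynomial ?A * ehrhart_polynomial ?B"
    proof (rule poly_eqI_positive_nats)
      fix m :: nat assume m: "1 \<le> m"
      have card_eq: "card ((\<lambda>x. real m *\<^sub>R x) ` P \<inter> integer_points) =
          card ((\<lambda>x. real m *\<^sub>R x) ` ?A \<inter> integer_points) *
          card ((\<lambda>x. real m *\<^sub>R x) ` ?B \<inter> integer_points)"
        by (rule card_integer_points_coordinate_split) (rule mixed)
      have "poly (ehrhart_polynomial P) (of_nat m) =
          of_nat (card ((\<lambda>x. real m *\<^sub>R x) ` P \<inter> integer_points))"
        using poly_ehrhart_polynomial[OF P(2,3) m] P(1) by simp
      also have "\<dots> = poly (ehrhart_polynomial ?A) (of_nat m) * poly (ehrhart_polynomial ?B) (of_nat m)"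
        unfolding card_eq V(3) W(3)
        using poly_ehrhart_polynomial[OF V(1,2) m] poly_ehrhart_polynomial[OF W(1,2) m] by simp
      finally show "poly (ehrhart_polynomial P) (of_nat m) =
          poly (ehrhart_polynomial ?A * ehrhart_polynomial ?B) (of_nat m)" by simp
    qed
    then show ?thesis
      using degree_ehrhart_polynomial_pos[OF V(1,2,4,5,6)] degree_ehrhart_polynomial_pos[OF W(1,2,4,5,6)]
      by (simp add: V(3) W(3) not_irreducible_mult)
  qed
  moreover have "\<not> coordinate_graph_connected P"
  proof
    assume "coordinate_graph_connected P"
    then have "(i, j) \<in> (coordinate_edges P)\<^sup>*" by (simp add: coordinate_graph_connected_def)
    then have "j \<in> I"
    proof (induction rule: rtrancl_induct)
      case (step k l)
      then obtain a where "facet_normal P a" "a $ k \<noteq> 0" "a $ l \<noteq> 0"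
        by (auto simp: coordinate_edges_def)
      with split step.IH show ?case by blast
    qed (use ij in simp)
    with ij show False by simp
  qed
  ultimately show False using assms(3) by blast
qed

end
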